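(* Let $b\ge 2$, and let $v_1=(0)$ (the root of $T_b(\infty)$) and $v_{m+1}$ the last son of $v_m$ for $m\ge1$, so that $v_1,v_2,\dots$ is the rightmost branch of $T_b(\infty)$. Then for every $i\ge1$: $v_i$ is the canonical base-$b$ representation of $i-1$ (i.e. the unique $b$-ary partition of $i-1$ all of whose components lie in $\{0,\dots,b-1\}$); $v_i$ has exactly $c_b(i)+1$ sons, the last of which is $v_{i+1}$; and for $1\le j\le c_b(i)$, the $j$-th son of $v_i$ is the root of an $X_{b,j}$ subtree of $T_b(\infty)$.
   Context: A $b$-ary partition of $n\ge0$ is a sequence $p=(p_0,p_1,\dots)$ of non-negative integers, finitely many nonzero, with $\sum_j p_jb^j=n$. For such $p$, let $l(p)$ be the largest $l\ge0$ with $p_0=\dots=p_{l-1}=b-1$, and for $0\le i\le l(p)$ let $\mathrm{inc}_i(p)=(0,\dots,0,p_i+1,p_{i+1},\dots)$ ($i$ leading zeros). The ordered rooted tree $T_b(\infty)$ has as nodes all $b$-ary partitions of all $n\ge0$, root $(0,0,\dots)$, and each node $p$ has exactly $l(p)+1$ ordered sons, the $(i+1)$-th being $\mathrm{inc}_i(p)$. For a node $p$, its rightmost branch is $w_1=p$, $w_{m+1}=$ last son of $w_m$. For $m\ge1$, $c_b(m)$ is the largest $k$ such that $b^k$ divides $m$. For $k\ge1$, $X_{b,k}$ is the ordered rooted tree (unique up to isomorphism, being determined level by level) whose rightmost branch $w_1,w_2,\dots$ satisfies: for each $1\le i\le b^{k-1}$, $w_i$ has exactly $c_b(i)+1$ sons,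 the last being $w_{i+1}$, and for $1\le l\le c_b(i)$ the subtree rooted at its $l$-th son is isomorphic to $X_{b,l}$; and the subtree rooted at $w_{b^{k-1}+1}$ is isomorphic to $X_{b,k}$. A node $p$ of $T_b(\infty)$ is the root of an $X_{b,k}$ subtree if the subtree consisting of $p$ and all its descendants is isomorphic, as an ordered rooted tree, to $X_{b,k}$. *)

theory Defs
  imports "HOL-Computational_Algebra.Primes"
begin

section \<open>Ordered rooted trees\<close>

text \<open>Trees may be infinite, but every node has a finite list of sons, in order.
  Outside the node set, the field \<open>tsons\<close> is irrelevant.\<close>

record 'a otree =
  tnodes :: "'a set"
  troot :: 'a
  tsons :: "'a \<Rightarrow> 'a list"

definition son_rel :: "'a otree \<Rightarrow> ('a \<times> 'a) set" where
  "son_rel T = {(p, q). q \<in> set (tsons T p)}"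

definition descendants :: "'a otree \<Rightarrow> 'a \<Rightarrow> 'a set" where
  "descendants T p = {q. (p, q) \<in> (son_rel T)\<^sup>*}"

lemma descendants_refl: "r \<in> descendants T r"
  unfolding descendants_def by simp

lemma descendants_closed:
  "p \<in> descendants T r \<Longrightarrow> q \<in> set (tsons T p) \<Longrightarrow> q \<in> descendants T r"
  unfolding descendants_def son_rel_def by (auto intro: rtrancl_into_rtrancl)

lemma descendants_induct [consumes 1, case_names root son]:
  assumes "p \<in> descendants T r" "P r"
    "\<And>p q. p \<in> descendants T r \<Longrightarrow> P p \<Longrightarrow> q \<in> set (tsons T p) \<Longrightarrow> P q"
  shows "P p"
proof -
  have "(r, p) \<in> (son_rel T)\<^sup>*" using assms(1) by (simp add: descendants_def)
  then show ?thesis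
  proof (induction rule: rtrancl_induct)
    case base show ?case by fact
  next
    case (step y z)
    then show ?case using assms(3)[of y z] by (auto simp: descendants_def son_rel_def)
  qed
qed

definition ordered_tree :: "'a otree \<Rightarrow> bool" where
  "ordered_tree T \<longleftrightarrow>
     tnodes T = descendants T (troot T) \<and>
     (\<forall>p\<in>tnodes T. distinct (tsons T p)) \<and>
     (\<forall>p\<in>tnodes T. troot T \<notin> set (tsons T p)) \<and>
     (\<forall>p\<in>tnodes T. \<forall>q\<in>tnodes T. p \<noteq> q \<longrightarrow> set (tsons T p) \<inter> set (tsons T q) = {})"

definition subtree :: "'a otree \<Rightarrow> 'a \<Rightarrow> 'a otree" where
  "subtree T p = \<lparr>tnodes = descendants T p, troot = p, tsons = tsons T\<rparr>"

definition tree_iso :: "'a otree \<Rightarrow> 'c otree \<Rightarrow> bool" where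
  "tree_iso S T \<longleftrightarrow>
     (\<exists>f. bij_betw f (tnodes S) (tnodes T) \<and> f (troot S) = troot T \<and>
          (\<forall>p\<in>tnodes S. tsons T (f p) = map f (tsons S p)))"

text \<open>The rightmost branch \<open>w\<^sub>1 = p, w\<^sub>2, \<dots>\<close> of a node \<open>p\<close>; the index starts at 1.\<close>

definition right_branch :: "'a otree \<Rightarrow> 'a \<Rightarrow> nat \<Rightarrow> 'a" where
  "right_branch T p m = ((\<lambda>q. last (tsons T q)) ^^ (m - 1)) p"


section \<open>The tree of \<open>b\<close>-ary partitions\<close>

definition bary_partition :: "nat \<Rightarrow> nat \<Rightarrow> (nat \<Rightarrow> nat) \<Rightarrow> bool" where
  "bary_partition b n p \<longleftrightarrow>
     finite {j. p j \<noteq> 0} \<and> (\<Sum>j | p j \<noteq> 0. p j * b ^ j) = n"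

definition canonical_rep :: "nat \<Rightarrow> nat \<Rightarrow> (nat \<Rightarrow> nat) \<Rightarrow> bool" where
  "canonical_rep b n p \<longleftrightarrow> bary_partition b n p \<and> (\<forall>j. p j \<in> {0..b - 1})"

definition lfull :: "nat \<Rightarrow> (nat \<Rightarrow> nat) \<Rightarrow> nat" where
  "lfull b p = (GREATEST l. \<forall>j<l. p j = b - 1)"

definition inc :: "nat \<Rightarrow> (nat \<Rightarrow> nat) \<Rightarrow> nat \<Rightarrow> nat" where
  "inc i p = (\<lambda>j. if j < i then 0 else if j = i then p i + 1 else p j)"

definition T_inf :: "nat \<Rightarrow> (nat \<Rightarrow> nat) otree" where
  "T_inf b = \<lparr>tnodes = {p. \<exists>n. bary_partition b n p},
              troot = (\<lambda>_. 0),
              tsons = (\<lambda>p. map (\<lambda>i. inc i p) [0..<lfull b p + 1])\<rparr>"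


text \<open>\<open>T_inf b\<close> is indeed a tree: every node other than the root is a son of exactly one node.\<close>

lemma lfull_props:
  assumes "b \<ge> 2" "finite {j. p j \<noteq> 0}"
  shows "j < lfull b p \<Longrightarrow> p j = b - 1" and "p (lfull b p) \<noteq> b - 1"
proof -
  obtain N where N: "\<forall>j\<in>{j. p j \<noteq> 0}. j < N"
    using assms(2) finite_nat_set_iff_bounded by blast
  have bd: "l \<le> N" if "\<forall>j<l. p j = b - 1" for l
  proof (rule ccontr)
    assume "\<not> l \<le> N"
    then have "p N = b - 1" using that by auto
    then have "p N \<noteq> 0" using assms(1) by simp
    then show False using N by blast
  qed
  have G: "\<forall>j<lfull b p. p j = b - 1"
    unfolding lfull_def by (rule GreatestI_nat[where k = 0 and b = N]) (use bd in auto)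
  then show "j < lfull b p \<Longrightarrow> p j = b - 1" by blast
  show "p (lfull b p) \<noteq> b - 1"
  proof
    assume "p (lfull b p) = b - 1"
    then have "\<forall>j<Suc (lfull b p). p j = b - 1" using G less_Suc_eq by auto
    then have "Suc (lfull b p) \<le> lfull b p"
      unfolding lfull_def by (rule Greatest_le_nat[where b = N]) (use bd in auto)
    then show False by simp
  qed
qed

lemma bary_iff: "(\<exists>n. bary_partition b n p) \<longleftrightarrow> finite {j. p j \<noteq> 0}"
  by (auto simp: bary_partition_def)

lemma inc_eqD:
  assumes b: "b \<ge> 2" and fin: "finite {j. p j \<noteq> 0}" "finite {j. q j \<noteq> 0}"
    and ij: "i \<le> lfull b p" "j \<le> lfull b q" and eq: "inc i p = inc j q"
  shows "p = q \<and> i = j"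
proof -
  have e: "inc i p k = inc j q k" for k using eq by simp
  have "\<not> i < j" using e[of i] by (auto simp: inc_def)
  moreover have "\<not> j < i" using e[of j] by (auto simp: inc_def)
  ultimately have ij': "i = j" by simp
  have "p k = q k" for k
  proof (cases "k < i")
    case True
    then show ?thesis using lfull_props(1)[OF b fin(1)] lfull_props(1)[OF b fin(2)] ij ij' by simp
  next
    case False
    then show ?thesis using e[of k] ij' by (simp add: inc_def split: if_splits)
  qed
  then show ?thesis using ij' by auto
qed

lemma T_inf_ordered_tree:
  assumes b: "b \<ge> 2"
  shows "ordered_tree (T_inf b)"
proof -
  have fin_inc: "finite {j. inc i p j \<noteq> 0}" if "finite {j. p j \<noteq> 0}" for i p
    by (rule finite_subset[OF _ finite.insertI[OF that, of i]]) (auto simp: inc_def)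
  have nz: "inc i p \<noteq> (\<lambda>_. 0)" for i p
  proof
    assume "inc i p = (\<lambda>_. 0)"
    then have "inc i p i = 0" by simp
    then show False by (simp add: inc_def)
  qed
  have sons: "q \<in> set (tsons (T_inf b) p) \<longleftrightarrow> (\<exists>i\<le>lfull b p. q = inc i p)" for p q
  proof -
    have "set (tsons (T_inf b) p) = (\<lambda>i. inc i p) ` {..lfull b p}"
      by (simp add: T_inf_def atLeast0LessThan lessThan_Suc_atMost del: upt_Suc)
    then show ?thesis by blast
  qed
  have up: "p \<in> descendants (T_inf b) (\<lambda>_. 0)" if "finite {j. p j \<noteq> 0}" for p
    using that
  proof (induction "\<Sum>j | p j \<noteq> 0. p j * b ^ j" arbitrary: p rule: less_induct)
    case less
    show ?case
    proof (cases "p = (\<lambda>_. 0)")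
      case False
      define i where "i = (LEAST i. p i \<noteq> 0)"
      have i: "p i \<noteq> 0" unfolding i_def by (rule LeastI_ex) (use False in auto)
      have i0: "p j = 0" if "j < i" for j using not_less_Least[of j "\<lambda>i. p i \<noteq> 0"] that unfolding i_def by simp
      define q where "q = (\<lambda>j. if j < i then b - 1 else if j = i then p i - 1 else p j)"
      have pq: "p = inc i q" using i i0 by (auto simp: q_def inc_def)
      have finq: "finite {j. q j \<noteq> 0}"
        by (rule finite_subset[of _ "{..i} \<union> {j. p j \<noteq> 0}"]) (use less.prems in \<open>auto simp: q_def\<close>)
      obtain N where N: "{j. p j \<noteq> 0} \<union> {j. q j \<noteq> 0} \<subseteq> {..<N}"
        using finite_nat_set_iff_bounded[of "{j. p j \<noteq> 0} \<union> {j. q j \<noteq> 0}"] less.prems finq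
        unfolding subset_eq lessThan_iff by blast
      have iN: "i < N" using N i by auto
      have sN: "(\<Sum>j | r j \<noteq> 0. r j * b ^ j) = (\<Sum>j<N. r j * b ^ j)"
        if "{j. r j \<noteq> 0} \<subseteq> {..<N}" for r :: "nat \<Rightarrow> nat"
        by (rule sum.mono_neutral_left) (use that in auto)
      have geo: "(\<Sum>j<i. (b - 1) * b ^ j) < b ^ i" for i
      proof (induction i)
        case (Suc i)
        have "b ^ i + (b - 1) * b ^ i = b ^ Suc i" using b by (cases b) auto
        then show ?case using Suc by simp
      qed simp
      have split: "(\<Sum>j<N. r j * b ^ j) =
          (\<Sum>j<i. r j * b ^ j) + r i * b ^ i + (\<Sum>j\<in>{i<..<N}. r j * b ^ j)" for r :: "nat \<Rightarrow> nat"
      proof -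
        have "{..<N} = insert i ({..<i} \<union> {i<..<N})" using iN by auto
        moreover have "{..<i} \<inter> {i<..<N} = {}" by auto
        ultimately show ?thesis by (simp add: sum.union_disjoint)
      qed
      have "(\<Sum>j<i. q j * b ^ j) < b ^ i" using geo[of i] by (simp add: q_def)
      moreover have "q i * b ^ i + b ^ i = p i * b ^ i"
        using i by (cases "p i") (auto simp: q_def)
      moreover have "(\<Sum>j\<in>{i<..<N}. q j * b ^ j) = (\<Sum>j\<in>{i<..<N}. p j * b ^ j)"
        by (rule sum.cong) (auto simp: q_def)
      ultimately have "(\<Sum>j<N. q j * b ^ j) < (\<Sum>j<N. p j * b ^ j)"
        using split[of q] split[of p] by linarith
      then have "(\<Sum>j | q j \<noteq> 0. q j * b ^ j) < (\<Sum>j | p j \<noteq> 0. p j * b ^ j)"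
        using sN N by simp
      then have qd: "q \<in> descendants (T_inf b) (\<lambda>_. 0)" using less.hyps finq by blast
      have "i \<le> lfull b q"
      proof (rule ccontr)
        assume "\<not> i \<le> lfull b q"
        then have "q (lfull b q) = b - 1" by (simp add: q_def)
        then show False using lfull_props(2)[OF b finq] by blast
      qed
      then have "p \<in> set (tsons (T_inf b) q)" using pq sons by blast
      with qd show ?thesis by (rule descendants_closed)
    qed (simp add: descendants_refl)
  qed
  have down: "finite {j. p j \<noteq> 0}" if "p \<in> descendants (T_inf b) (\<lambda>_. 0)" for p
    using that
  proof (induction rule: descendants_induct)
    case (son p q)
    from son.hyps(2) obtain i where "q = inc i p" unfolding sons by blast
    then show ?case using fin_inc[OF son.IH] by simp
  qed simp
  show ?thesis
    unfolding ordered_tree_def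
  proof (intro conjI ballI impI)
    show "tnodes (T_inf b) = descendants (T_inf b) (troot (T_inf b))"
    proof -
      have "tnodes (T_inf b) = {p. finite {j. p j \<noteq> 0}}" "troot (T_inf b) = (\<lambda>_. 0)"
        by (simp_all add: T_inf_def bary_iff)
      moreover have "{p. finite {j. p j \<noteq> 0}} = descendants (T_inf b) (\<lambda>_. 0)"
        by (rule set_eqI, unfold mem_Collect_eq, rule iffI[OF up down])
      ultimately show ?thesis by simp
    qed
    fix p assume "p \<in> tnodes (T_inf b)"
    then have p: "finite {j. p j \<noteq> 0}" by (simp add: T_inf_def bary_iff)
    show "distinct (tsons (T_inf b) p)"
      using inc_eqD[OF b p p] by (simp add: T_inf_def distinct_map inj_on_def less_Suc_eq_le del: upt_Suc)
    show "troot (T_inf b) \<notin> set (tsons (T_inf b) p)"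
    proof
      assume "troot (T_inf b) \<in> set (tsons (T_inf b) p)"
      then obtain i where "troot (T_inf b) = inc i p" unfolding sons by blast
      then show False using nz[of i p] by (simp add: T_inf_def)
    qed
    fix q assume "q \<in> tnodes (T_inf b)" "p \<noteq> q"
    then have q: "finite {j. q j \<noteq> 0}" by (simp add: T_inf_def bary_iff)
    show "set (tsons (T_inf b) p) \<inter> set (tsons (T_inf b) q) = {}"
    proof (rule ccontr)
      assume "set (tsons (T_inf b) p) \<inter> set (tsons (T_inf b) q) \<noteq> {}"
      then obtain r where "r \<in> set (tsons (T_inf b) p)" "r \<in> set (tsons (T_inf b) q)" by blast
      then obtain i j where ij: "i \<le> lfull b p" "r = inc i p" "j \<le> lfull b q" "r = inc j q"
        unfolding sons by blast
      have "inc i p = inc j q" using ij by simp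
      with inc_eqD[OF b p q ij(1,3)] \<open>p \<noteq> q\<close> show False by simp
    qed
  qed
qed


section \<open>The trees \<open>X\<^bsub>b,k\<^esub>\<close>\<close>

text \<open>The defining property of the whole family \<open>(X\<^bsub>b,k\<^esub>)\<close>, \<open>k \<ge> 1\<close> (the value \<open>X 0\<close> is
  irrelevant).  The number \<open>c\<^sub>b(m)\<close> is \<open>multiplicity b m\<close>.\<close>

definition X_family :: "nat \<Rightarrow> (nat \<Rightarrow> 'a otree) \<Rightarrow> bool" where
  "X_family b X \<longleftrightarrow>
     (\<forall>k\<ge>1. ordered_tree (X k) \<and>
        (let w = right_branch (X k) (troot (X k)) in
          (\<forall>i\<in>{1..b ^ (k - 1)}.
             length (tsons (X k) (w i)) = multiplicity b i + 1 \<and>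
             last (tsons (X k) (w i)) = w (i + 1) \<and>
             (\<forall>l\<in>{1..multiplicity b i}.
                tree_iso (subtree (X k) (tsons (X k) (w i) ! (l - 1))) (X l))) \<and>
          tree_iso (subtree (X k) (w (b ^ (k - 1) + 1))) (X k)))"

text \<open>The defining property determines every \<open>X k\<close>, \<open>k \<ge> 1\<close>, up to isomorphism.
  Two trees are compared level by level: \<open>sim n\<close> says that the subtrees at two nodes have the same
  shape down to depth \<open>n\<close>.\<close>

primrec sim :: "nat \<Rightarrow> ('a \<Rightarrow> 'a list) \<Rightarrow> ('c \<Rightarrow> 'c list) \<Rightarrow> 'a \<Rightarrow> 'c \<Rightarrow> bool" where
  "sim 0 s t p q = True"
| "sim (Suc n) s t p q = list_all2 (sim n s t) (s p) (t q)"

lemma sim_sym: "sim n s t p q \<Longrightarrow> sim n t s q p"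
  by (induction n arbitrary: p q) (auto simp: list_all2_conv_all_nth)

lemma sim_trans: "sim n s t p q \<Longrightarrow> sim n t u q r \<Longrightarrow> sim n s u p r"
proof (induction n arbitrary: p q r)
  case (Suc n)
  show ?case
    unfolding sim.simps
    by (rule list_all2_trans[OF Suc.IH Suc.prems[unfolded sim.simps]])
qed simp

lemma tree_iso_sim:
  assumes "tree_iso S T" "tnodes S = descendants S (troot S)"
  shows "sim n (tsons S) (tsons T) (troot S) (troot T)"
proof -
  obtain f where f: "f (troot S) = troot T"
    "\<And>p. p \<in> tnodes S \<Longrightarrow> tsons T (f p) = map f (tsons S p)"
    using assms(1) unfolding tree_iso_def by blast
  have "sim n (tsons S) (tsons T) p (f p)" if "p \<in> tnodes S" for p
    using that
  proof (induction n arbitrary: p)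
    case (Suc n)
    then show ?case
      using descendants_closed[of p S "troot S"] assms(2) f(2)[OF Suc.prems]
      by (auto simp: list_all2_conv_all_nth)
  qed simp
  then show ?thesis using f(1) assms(2) descendants_refl by metis
qed

lemma subtree_iso_sim:
  assumes "tree_iso (subtree S p) T"
  shows "sim n (tsons S) (tsons T) p (troot T)"
proof -
  have "tnodes (subtree S p) = descendants (subtree S p) (troot (subtree S p))"
    by (simp add: subtree_def descendants_def son_rel_def)
  from tree_iso_sim[OF assms this, of n] show ?thesis by (simp add: subtree_def)
qed

inductive corr :: "'a otree \<Rightarrow> 'c otree \<Rightarrow> 'a \<Rightarrow> 'c \<Rightarrow> bool" for S T where
  root: "corr S T (troot S) (troot T)"
| son: "corr S T p q \<Longrightarrow> i < length (tsons S p) \<Longrightarrow> i < length (tsons T q) \<Longrightarrow>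
    corr S T (tsons S p ! i) (tsons T q ! i)"

lemma corr_sym: "corr S T p q \<Longrightarrow> corr T S q p"
  by (induction rule: corr.induct) (auto intro: corr.intros)

lemma corr_node: "corr S T p q \<Longrightarrow> ordered_tree S \<Longrightarrow> p \<in> tnodes S"
  by (induction rule: corr.induct)
    (auto simp: ordered_tree_def intro: descendants_refl descendants_closed)

lemma tree_son_not_root:
  assumes "ordered_tree S" "p \<in> tnodes S" "i < length (tsons S p)"
  shows "tsons S p ! i \<noteq> troot S"
proof -
  have "troot S \<notin> set (tsons S p)" using assms(1,2) unfolding ordered_tree_def by blast
  then show ?thesis using nth_mem[OF assms(3)] by auto
qed

lemma tree_son_inj:
  assumes S: "ordered_tree S" and p: "p \<in> tnodes S" "p' \<in> tnodes S"
    and i: "i < length (tsons S p)" "i' < length (tsons S p')"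
    and eq: "tsons S p ! i = tsons S p' ! i'"
  shows "p = p' \<and> i = i'"
proof -
  have "tsons S p ! i \<in> set (tsons S p) \<inter> set (tsons S p')"
    using nth_mem[OF i(1)] nth_mem[OF i(2)] eq by simp
  then have "p = p'" using S p unfolding ordered_tree_def by blast
  moreover have "distinct (tsons S p)" using S p unfolding ordered_tree_def by blast
  ultimately show ?thesis using i eq by (simp add: nth_eq_iff_index_eq)
qed

lemma corr_fun:
  assumes "corr S T p q" "corr S T p q'" "ordered_tree S"
  shows "q = q'"
  using assms(1,2)
proof (induction arbitrary: q' rule: corr.induct)
  case root
  then show ?case
  proof cases
    case (son p q i)
    then show ?thesis
      using tree_son_not_root[OF assms(3) corr_node[OF son(3) assms(3)] son(4)] by simp
  qed simp
next
  case (son p q i)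
  note ps = corr_node[OF son.hyps(1) assms(3)]
  from son.prems show ?case
  proof cases
    case root
    then show ?thesis using tree_son_not_root[OF assms(3) ps son.hyps(2)] by simp
  next
    case (son p2 q2 i2)
    have "p = p2 \<and> i = i2"
      by (rule tree_son_inj[OF assms(3) ps corr_node[OF son(3) assms(3)]
            \<open>i < length (tsons S p)\<close> son(4) son(1)])
    then show ?thesis using son(2,3) \<open>\<And>q'. corr S T p q' \<Longrightarrow> q = q'\<close> by simp
  qed
qed

lemma corr_sim:
  assumes "corr S T p q" "\<And>n. sim n (tsons S) (tsons T) (troot S) (troot T)"
  shows "sim n (tsons S) (tsons T) p q"
  using assms(1)
proof (induction arbitrary: n rule: corr.induct)
  case root show ?case by fact
next
  case (son p q i)
  have "sim (Suc n) (tsons S) (tsons T) p q" by (rule son.IH)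
  then show ?case using son.hyps(2) by (simp add: list_all2_conv_all_nth)
qed

lemma corr_len:
  assumes "corr S T p q" "\<And>n. sim n (tsons S) (tsons T) (troot S) (troot T)"
  shows "length (tsons S p) = length (tsons T q)"
proof -
  have "sim (Suc 0) (tsons S) (tsons T) p q" by (rule corr_sim[OF assms])
  then show ?thesis unfolding sim.simps by (rule list_all2_lengthD)
qed

lemma corr_total:
  assumes "\<And>n. sim n (tsons S) (tsons T) (troot S) (troot T)" "ordered_tree S" "p \<in> tnodes S"
  shows "\<exists>q. corr S T p q"
proof -
  have "p \<in> descendants S (troot S)" using assms(2,3) unfolding ordered_tree_def by blast
  then show ?thesis
  proof (induction rule: descendants_induct)
    case root show ?case by (blast intro: corr.root)
  next
    case (son p r)
    then obtain q where q: "corr S T p q" by blast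
    have "length (tsons S p) = length (tsons T q)"
      by (rule corr_len[OF q assms(1)])
    moreover obtain i where "i < length (tsons S p)" "r = tsons S p ! i"
      using son.hyps(2) unfolding in_set_conv_nth by blast
    ultimately have "corr S T r (tsons T q ! i)" using corr.son[OF q, of i] by simp
    then show ?case ..
  qed
qed

lemma sim_tree_iso:
  assumes sim: "\<And>n. sim n (tsons S) (tsons T) (troot S) (troot T)"
    and S: "ordered_tree S" and T: "ordered_tree T"
  shows "tree_iso S T"
proof -
  have sim': "sim n (tsons T) (tsons S) (troot T) (troot S)" for n
    by (rule sim_sym[OF sim])
  define f where "f p = (THE q. corr S T p q)" for p
  have f: "f p = q" if "corr S T p q" for p q
    unfolding f_def by (rule the_equality[where P = "corr S T p", OF that corr_fun[OF _ that S]])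
  have fc: "corr S T p (f p)" if p: "p \<in> tnodes S" for p
  proof -
    obtain q where "corr S T p q" using corr_total[OF sim S p] ..
    with f[OF this] show ?thesis by simp
  qed
  have "bij_betw f (tnodes S) (tnodes T)"
  proof (rule bij_betwI')
    show "(f p = f q) = (p = q)" if "p \<in> tnodes S" "q \<in> tnodes S" for p q
      using corr_fun[OF corr_sym[OF fc[OF that(1)]] _ T, of q] corr_sym[OF fc[OF that(2)]] by auto
    show "f p \<in> tnodes T" if "p \<in> tnodes S" for p
      using corr_node[OF corr_sym[OF fc[OF that]] T] .
    show "\<exists>p\<in>tnodes S. q = f p" if q: "q \<in> tnodes T" for q
    proof -
      obtain p where "corr T S q p" using corr_total[OF sim' T q] ..
      then have c: "corr S T p q" by (rule corr_sym)
      show ?thesis using f[OF c] corr_node[OF c S] by blast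
    qed
  qed
  moreover have "f (troot S) = troot T" by (rule f[OF corr.root])
  moreover have "tsons T (f p) = map f (tsons S p)" if p: "p \<in> tnodes S" for p
  proof (rule nth_equalityI)
    show l: "length (tsons T (f p)) = length (map f (tsons S p))"
      using corr_len[OF fc[OF p] sim] by simp
    show "tsons T (f p) ! i = map f (tsons S p) ! i" if i: "i < length (tsons T (f p))" for i
      using f[OF corr.son[OF fc[OF p], of i]] i l by simp
  qed
  ultimately show ?thesis unfolding tree_iso_def by blast
qed

lemma X_family_branch:
  assumes "X_family b X" "k \<ge> 1" "i \<in> {1..b ^ (k - 1)}"
  defines "w \<equiv> right_branch (X k) (troot (X k))"
  shows "length (tsons (X k) (w i)) = multiplicity b i + 1"
    and "last (tsons (X k) (w i)) = w (i + 1)"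
    and "l \<in> {1..multiplicity b i} \<Longrightarrow>
           tree_iso (subtree (X k) (tsons (X k) (w i) ! (l - 1))) (X l)"
  using assms(1)[unfolded X_family_def Let_def, THEN spec, THEN mp, OF assms(2)] assms(3)
  unfolding w_def by blast+

lemma X_family_rec:
  assumes "X_family b X" "k \<ge> 1"
  shows "tree_iso (subtree (X k) (right_branch (X k) (troot (X k)) (b ^ (k - 1) + 1))) (X k)"
    and "ordered_tree (X k)"
  using assms(1)[unfolded X_family_def Let_def, THEN spec, THEN mp, OF assms(2)] by blast+

lemma X_family_sim:
  assumes b: "b \<ge> 2" and X: "X_family b X" and Y: "X_family b Y"
  defines "w \<equiv> \<lambda>k. right_branch (X k) (troot (X k))"
    and "w' \<equiv> \<lambda>k. right_branch (Y k) (troot (Y k))"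
  assumes "k \<ge> 1" "i \<in> {1..b ^ (k - 1) + 1}"
  shows "sim n (tsons (X k)) (tsons (Y k)) (w k i) (w' k i)"
  using assms(6,7)
proof (induction n arbitrary: k i)
  case (Suc n)
  note branchX = X_family_branch[OF X] and branchY = X_family_branch[OF Y]
    and recX = X_family_rec[OF X] and recY = X_family_rec[OF Y]
  have w1: "w k 1 = troot (X k)" "w' k 1 = troot (Y k)" for k
    by (simp_all add: w_def w'_def right_branch_def)
  have *: "sim (Suc n) (tsons (X k)) (tsons (Y k)) (w k i) (w' k i)"
    if i: "i \<in> {1..b ^ (k - 1)}" for i
  proof -
    let ?s = "tsons (X k) (w k i)" and ?t = "tsons (Y k) (w' k i)" and ?c = "multiplicity b i"
    have len: "length ?s = ?c + 1" "length ?t = ?c + 1"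
      and lst: "last ?s = w k (i + 1)" "last ?t = w' k (i + 1)"
      and isoX: "\<And>l. l \<in> {1..?c} \<Longrightarrow> tree_iso (subtree (X k) (?s ! (l - 1))) (X l)"
      and isoY: "\<And>l. l \<in> {1..?c} \<Longrightarrow> tree_iso (subtree (Y k) (?t ! (l - 1))) (Y l)"
      using branchX[OF Suc.prems(1) i] branchY[OF Suc.prems(1) i] by (simp_all add: w_def w'_def)
    have "sim n (tsons (X k)) (tsons (Y k)) (?s ! j) (?t ! j)" if "j < ?c + 1" for j
    proof (cases "j = ?c")
      case True
      then have "?s ! j = last ?s" "?t ! j = last ?t"
        using len by (metis add_diff_cancel_right' last_conv_nth length_0_conv add_is_0 zero_neq_one)+
      then show ?thesis using lst Suc.IH[OF \<open>k \<ge> 1\<close>, of "i + 1"] i by simp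
    next
      case False
      then have j: "j + 1 \<in> {1..?c}" using that by simp
      have "sim n (tsons (X (j + 1))) (tsons (Y (j + 1))) (w (j + 1) 1) (w' (j + 1) 1)"
        by (rule Suc.IH) auto
      then have "sim n (tsons (X (j + 1))) (tsons (Y (j + 1))) (troot (X (j + 1))) (troot (Y (j + 1)))"
        by (simp only: w1)
      then show ?thesis
        using sim_trans[OF subtree_iso_sim[OF isoX[OF j]]
            sim_trans[OF _ sim_sym[OF subtree_iso_sim[OF isoY[OF j]]]]] by simp
    qed
    then show ?thesis using len by (simp add: list_all2_conv_all_nth)
  qed
  show ?case
  proof (cases "i = b ^ (k - 1) + 1")
    case False
    then show ?thesis using * Suc.prems by simp
  next
    case True
    have "sim (Suc n) (tsons (X k)) (tsons (Y k)) (troot (X k)) (troot (Y k))"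
      using *[of 1] b by (simp only: w1) simp
    moreover have "tree_iso (subtree (X k) (w k i)) (X k)" "tree_iso (subtree (Y k) (w' k i)) (Y k)"
      using recX[OF Suc.prems(1)] recY[OF Suc.prems(1)] True by (simp_all add: w_def w'_def)
    ultimately show ?thesis
      by (blast intro: sim_trans[OF subtree_iso_sim sim_trans[OF _ sim_sym[OF subtree_iso_sim]]])
  qed
qed simp

lemma X_family_unique:
  assumes "b \<ge> 2" "X_family b X" "X_family b Y" "k \<ge> 1"
  shows "tree_iso (X k) (Y k)"
proof (rule sim_tree_iso)
  show "sim n (tsons (X k)) (tsons (Y k)) (troot (X k)) (troot (Y k))" for n
    using X_family_sim[OF assms, of 1 n] assms(1) by (simp add: right_branch_def)
  show "ordered_tree (X k)" "ordered_tree (Y k)"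
    using assms X_family_rec(2) by blast+
qed

text \<open>The family is determined only up to isomorphism, so \<open>X\<^bsub>b,k\<^esub>\<close> is used through its
  isomorphism class.  Finite sequences of naturals serve as node labels for its representatives:
  every finitely branching tree is isomorphic to one whose nodes are such sequences.\<close>

definition X_subtree_root :: "(nat \<Rightarrow> nat) otree \<Rightarrow> nat \<Rightarrow> nat \<Rightarrow> (nat \<Rightarrow> nat) \<Rightarrow> bool" where
  "X_subtree_root T b k p \<longleftrightarrow>
     p \<in> tnodes T \<and>
     (\<exists>X :: nat \<Rightarrow> nat list otree. X_family b X \<and> tree_iso (subtree T p) (X k))"

end

(*
  The shape of the subtree of T_b(infinity) below p is determined by p_0, ..., p_(k-2) as soon as
  p_(k-1) >= b: that component never becomes b - 1 again, so no descendant arises from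
  incrementing a position beyond k - 1.  Hence all nodes of the form (0, ..., 0, p_(k-1), ...)
  with k - 1 zeros and p_(k-1) >= b have isomorphic subtrees, and these turn out to be X_{b,k}:
  along the rightmost branch the first k - 1 components count upwards in base b, and the
  other sons of a node on that branch are again of this form, for smaller k.
*)

theory Submission imports Defs "HOL-Library.More_List" begin

section \<open>Subtrees, relabelling and comparison of ordered trees\<close>

lemma descendants_trans: "p \<in> descendants T r \<Longrightarrow> q \<in> descendants T p \<Longrightarrow> q \<in> descendants T r"
  unfolding descendants_def by auto

lemma descendants_subtree [simp]: "descendants (subtree T p) = descendants T"
  by (simp add: fun_eq_iff subtree_def descendants_def son_rel_def)

lemma subtree_simps [simp]:
  "tnodes (subtree T p) = descendants T p" "troot (subtree T p) = p" "tsons (subtree T p) = tsons T"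
  by (simp_all add: subtree_def)

text \<open>\<open>ordered_tree\<close> asks only that the root is no son and that parents are
  unique. A cycle through a son \<open>r\<close> of \<open>p\<close> must enter \<open>r\<close>
  from \<open>p\<close>, so it would pass through \<open>p\<close> as well; this is ruled out by
  descending from the root.\<close>

lemma ordered_tree_no_cycle:
  assumes T: "ordered_tree T" and "p \<in> tnodes T" and q: "q \<in> descendants T p"
  shows "p \<notin> set (tsons T q)"
proof -
  have nodes: "tnodes T = descendants T (troot T)" using T by (simp add: ordered_tree_def)
  have "\<forall>q\<in>descendants T p. p \<notin> set (tsons T q)" using assms(2)[unfolded nodes]
  proof (induction rule: descendants_induct)
    case root
    then show ?case using T unfolding ordered_tree_def by simp
  next
    case (son p r)
    show ?case
    proof
      fix q assume q: "q \<in> descendants T r"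
      have r: "r \<in> descendants T p" using descendants_closed[OF descendants_refl son.hyps(2)] .
      have qp: "q \<in> descendants T p" using descendants_trans[OF r q] .
      show "r \<notin> set (tsons T q)"
      proof
        assume rq: "r \<in> set (tsons T q)"
        have "q \<in> tnodes T" "p \<in> tnodes T"
          using nodes son.hyps(1) descendants_trans[OF son.hyps(1) qp] by simp_all
        then have "q = p" using T rq son.hyps(2) unfolding ordered_tree_def by blast
        then have pr: "p \<in> descendants T r" using q by simp
        \<comment> \<open>The last edge of the path from \<open>r\<close> to \<open>p\<close>. If
          \<open>p = r\<close>, then \<open>p\<close> would be its own son, against the induction
          hypothesis.\<close>
        then obtain s where "s \<in> descendants T r" "p \<in> set (tsons T s)" if "p \<noteq> r"
          unfolding descendants_def by (auto elim: rtranclE simp: son_rel_def)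
        moreover have "p \<noteq> r" using son.IH rq \<open>q = p\<close> descendants_refl by metis
        ultimately show False using son.IH descendants_trans[OF r] by blast
      qed
    qed
  qed
  then show ?thesis using q by blast
qed

text \<open>Distinctness and disjointness of sons are inherited; that the new root is no son is
  acyclicity.\<close>

lemma ordered_tree_subtree:
  assumes T: "ordered_tree T" and p: "p \<in> tnodes T"
  shows "ordered_tree (subtree T p)"
proof -
  have sub: "q \<in> tnodes T" if "q \<in> descendants T p" for q
    using T p descendants_trans[OF _ that] by (auto simp: ordered_tree_def)
  show ?thesis
    using T sub ordered_tree_no_cycle[OF T p] unfolding ordered_tree_def by auto
qed

text \<open>The nodes of \<open>T_inf b\<close> are functions, while \<open>X_subtree_root\<close>
  asks for a family labelled by lists; this changes the label type.\<close>

lemma ordered_tree_relabel: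
  fixes S :: "'a otree" and g :: "'a \<Rightarrow> 'c"
  assumes S: "ordered_tree S" and inj: "inj_on g (tnodes S)"
  obtains R :: "'c otree" where "ordered_tree R" "tree_iso S R"
proof
  let ?h = "inv_into (tnodes S) g"
  define R where "R = \<lparr>tnodes = g ` tnodes S, troot = g (troot S),
    tsons = (\<lambda>y. map g (tsons S (?h y)))\<rparr>"
  have nodes: "tnodes S = descendants S (troot S)" using S by (simp add: ordered_tree_def)
  have sons: "tsons R (g p) = map g (tsons S p)" if "p \<in> tnodes S" for p
    using that inj by (simp add: R_def)
  have closed: "q \<in> tnodes S" if "p \<in> tnodes S" "q \<in> set (tsons S p)" for p q
    using that unfolding nodes by (rule descendants_closed)
  have root: "troot S \<in> tnodes S" unfolding nodes by (rule descendants_refl)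
  have R: "tnodes R = g ` tnodes S" "troot R = g (troot S)" by (simp_all add: R_def)
  have "g p \<in> descendants R (g (troot S))" if "p \<in> tnodes S" for p
    using that unfolding nodes
  proof (induction rule: descendants_induct)
    case (son p q)
    then show ?case using sons[of p] nodes by (auto intro: descendants_closed)
  qed (rule descendants_refl)
  moreover have "x \<in> g ` tnodes S" if "x \<in> descendants R (g (troot S))" for x
    using that
  proof (induction rule: descendants_induct)
    case (son x y)
    then show ?case using sons closed by auto
  qed (use root in simp)
  ultimately have D: "tnodes R = descendants R (troot R)" unfolding R by blast
  show "ordered_tree R"
    unfolding ordered_tree_def
  proof (intro conjI ballI impI)
    fix x assume "x \<in> tnodes R"
    then obtain p where p: "p \<in> tnodes S" "x = g p" unfolding R by blast
    have inj': "inj_on g (set (tsons S p))"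
      by (rule inj_on_subset[OF inj]) (use closed p in blast)
    show "distinct (tsons R x)"
      using S p inj' by (simp add: sons distinct_map ordered_tree_def)
    show "troot R \<notin> set (tsons R x)"
    proof
      assume "troot R \<in> set (tsons R x)"
      then obtain q where "q \<in> set (tsons S p)" "g q = g (troot S)"
        using sons p R by auto
      then have "troot S \<in> set (tsons S p)" using inj_onD[OF inj] closed p root by metis
      then show False using S p by (simp add: ordered_tree_def)
    qed
    fix y assume "y \<in> tnodes R" and xy: "x \<noteq> y"
    then obtain q where q: "q \<in> tnodes S" "y = g q" unfolding R by blast
    have "p \<noteq> q" using p q xy by blast
    then have "set (tsons S p) \<inter> set (tsons S q) = {}"
      using S p(1) q(1) unfolding ordered_tree_def by blast
    moreover have "set (tsons S p) \<subseteq> tnodes S" "set (tsons S q) \<subseteq> tnodes S"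
      using closed p q by blast+
    ultimately show "set (tsons R x) \<inter> set (tsons R y) = {}"
      using inj_on_image_Int[OF inj, of "set (tsons S p)" "set (tsons S q)"] p q by (simp add: sons)
  qed (rule D)
  show "tree_iso S R"
    unfolding tree_iso_def
    by (rule exI[of _ g]) (use inj sons R in \<open>simp add: inj_on_imp_bij_betw\<close>)
qed

section \<open>Agreement to every depth, and rightmost branches\<close>

lemma sim_length:
  assumes "\<And>n. sim n s t p q"
  shows "length (s p) = length (t q)"
  using assms[of 1] by (auto dest: list_all2_lengthD)

text \<open>Passing to a son costs one level of depth, so agreement to all depths is the hypothesis
  that survives iteration.\<close>

lemma sim_nth:
  assumes "\<And>n. sim n s t p q" "i < length (t q)"
  shows "sim n s t (s p ! i) (t q ! i)"
  using assms(1)[of "Suc n"] assms(2) by (simp add: list_all2_conv_all_nth)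

text \<open>Equal numbers of sons put the last sons at the same index, so \<open>sim_nth\<close>
  applies at each step down the branch.\<close>

lemma sim_right_branch:
  assumes "\<And>n. sim n (tsons S) (tsons T) p q" "\<And>r. tsons T r \<noteq> []"
  shows "sim n (tsons S) (tsons T) (right_branch S p m) (right_branch T q m)"
proof -
  have "\<forall>n. sim n (tsons S) (tsons T) (((\<lambda>q. last (tsons S q)) ^^ m) p) (((\<lambda>q. last (tsons T q)) ^^ m) q)" for m
  proof (induction m)
    case (Suc m)
    let ?p = "((\<lambda>q. last (tsons S q)) ^^ m) p" and ?q = "((\<lambda>q. last (tsons T q)) ^^ m) q"
    have s: "\<And>n. sim n (tsons S) (tsons T) ?p ?q" using Suc by blast
    have l: "length (tsons S ?p) = length (tsons T ?q)" by (rule sim_length[OF s])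
    then have "last (tsons S ?p) = tsons S ?p ! (length (tsons T ?q) - 1)"
      using assms(2)[of ?q] by (metis last_conv_nth length_0_conv)
    moreover have "last (tsons T ?q) = tsons T ?q ! (length (tsons T ?q) - 1)"
      using assms(2) by (simp add: last_conv_nth)
    moreover have "length (tsons T ?q) - 1 < length (tsons T ?q)" using assms(2) by simp
    ultimately show ?case using sim_nth[OF s] by simp
  qed (use assms(1) in simp)
  then show ?thesis unfolding right_branch_def by blast
qed

text \<open>Because \<open>m - 1\<close> is truncated, indices 0 and 1 both denote \<open>p\<close>;
  the recursion starts at 1.\<close>

lemma right_branch_Suc:
  "m \<ge> 1 \<Longrightarrow> right_branch T p (Suc m) = last (tsons T (right_branch T p m))"
  by (cases m) (simp_all add: right_branch_def)

lemma right_branch_node: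
  assumes "p \<in> descendants T r" "\<And>i. 1 \<le> i \<Longrightarrow> i < m \<Longrightarrow> tsons T (right_branch T p i) \<noteq> []"
  shows "right_branch T p m \<in> descendants T r"
  using assms(2)
proof (induction m)
  case (Suc m)
  show ?case
  proof (cases "m = 0")
    case False
    then have "right_branch T p m \<in> descendants T r" using Suc by simp
    moreover have "last (tsons T (right_branch T p m)) \<in> set (tsons T (right_branch T p m))"
      using Suc.prems[of m] False by simp
    ultimately show ?thesis using False by (simp add: right_branch_Suc descendants_closed)
  qed (use assms(1) in \<open>simp add: right_branch_def\<close>)
qed (use assms(1) in \<open>simp add: right_branch_def\<close>)


section \<open>Base-\<open>b\<close> digits\<close>

definition digits :: "nat \<Rightarrow> nat \<Rightarrow> nat \<Rightarrow> nat" where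
  "digits b n = (\<lambda>j. n div b ^ j mod b)"

lemma digits_0 [simp]: "digits b 0 = (\<lambda>_. 0)"
  by (simp add: digits_def)

lemma finite_digits:
  assumes "b \<ge> 2"
  shows "finite {j. digits b n j \<noteq> 0}"
proof (rule finite_subset)
  have "j < n" if j: "j \<in> {j. digits b n j \<noteq> 0}" for j
  proof (rule ccontr)
    assume "\<not> j < n"
    have "n < 2 ^ n" by (rule less_exp)
    also have "\<dots> \<le> b ^ n" using assms by (rule power_mono) simp
    also have "\<dots> \<le> b ^ j" using assms \<open>\<not> j < n\<close> by (intro power_increasing) auto
    finally show False using j by (simp add: digits_def)
  qed
  then show "{j. digits b n j \<noteq> 0} \<subseteq> {..<n}" by (auto simp del: mem_Collect_eq)
qed simp

text \<open>The remainder appears because the digits from \<open>N\<close> on are cut off; it is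
  \<open>n\<close> itself once \<open>n < b ^ N\<close>.\<close>

lemma sum_digits: "(\<Sum>j<N. digits b n j * b ^ j) = n mod b ^ N"
proof (induction N)
  case (Suc N)
  have "n mod b ^ Suc N = b ^ N * (n div b ^ N mod b) + n mod b ^ N"
    by (metis mod_mult2_eq power_Suc2)
  then show ?case using Suc by (simp add: digits_def mult.commute)
qed simp

text \<open>Uniqueness of base-\<open>b\<close> expansions. Dividing by \<open>b\<close> drops
  \<open>p 0\<close> and shifts the sequence, so the induction on \<open>i\<close> needs arbitrary
  \<open>p\<close> and \<open>N\<close>.\<close>

lemma digits_sum:
  assumes "\<And>j. p j < b" "i < N"
  shows "digits b (\<Sum>j<N. p j * b ^ j) i = p i"
  using assms
proof (induction i arbitrary: p N)
  case (Suc i)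
  then obtain M where N: "N = Suc M" by (cases N) auto
  have "(\<Sum>j<N. p j * b ^ j) = p 0 + b * (\<Sum>j<M. p (Suc j) * b ^ j)"
    unfolding N sum.lessThan_Suc_shift by (simp add: sum_distrib_left ac_simps)
  then have "(\<Sum>j<N. p j * b ^ j) div b = (\<Sum>j<M. p (Suc j) * b ^ j)"
    using Suc.prems(1)[of 0] by simp
  then have "digits b (\<Sum>j<N. p j * b ^ j) (Suc i) = digits b (\<Sum>j<M. p (Suc j) * b ^ j) i"
    by (simp add: digits_def div_mult2_eq)
  also have "\<dots> = p (Suc i)" using Suc.prems N by (intro Suc.IH) auto
  finally show ?case .
next
  case 0
  then obtain M where N: "N = Suc M" by (cases N) auto
  have "(\<Sum>j<N. p j * b ^ j) = p 0 + b * (\<Sum>j<M. p (Suc j) * b ^ j)"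
    unfolding N sum.lessThan_Suc_shift by (simp add: sum_distrib_left ac_simps)
  then show ?case using 0(1)[of 0] by (simp add: digits_def)
qed

lemma canonical_rep_iff_digits:
  assumes b: "b \<ge> 2"
  shows "canonical_rep b n p \<longleftrightarrow> p = digits b n"
proof
  have le: "x \<in> {0..b - 1} \<longleftrightarrow> x < b" for x using b by auto
  have sum_eq: "(\<Sum>j | r j \<noteq> 0. r j * b ^ j) = (\<Sum>j<N. r j * b ^ j)"
    if "{j. r j \<noteq> 0} \<subseteq> {..<N}" for r :: "nat \<Rightarrow> nat" and N
    by (rule sum.mono_neutral_left) (use that in auto)
  show "p = digits b n" if "canonical_rep b n p"
  proof
    fix i
    from that have fin: "finite {j. p j \<noteq> 0}" and n: "(\<Sum>j | p j \<noteq> 0. p j * b ^ j) = n"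
      and lt: "\<And>j. p j < b"
      unfolding canonical_rep_def bary_partition_def le by auto
    \<comment> \<open>The bound must also cover \<open>i\<close>, which may lie outside the
      support.\<close>
    obtain N where N: "insert i {j. p j \<noteq> 0} \<subseteq> {..<N}"
      using finite_nat_set_iff_bounded[of "insert i {j. p j \<noteq> 0}"] fin unfolding subset_eq lessThan_iff by blast
    show "p i = digits b n i"
      using digits_sum[OF lt, where i = i and N = N] n sum_eq[of p N] N by simp
  qed
  show "canonical_rep b n p" if p: "p = digits b n"
  proof -
    have fin: "finite {j. p j \<noteq> 0}" unfolding p by (rule finite_digits[OF b])
    then obtain N0 where N0: "{j. p j \<noteq> 0} \<subseteq> {..<N0}"
      using finite_nat_set_iff_bounded unfolding subset_eq lessThan_iff by blast
    \<comment> \<open>Large enough for the support and, since \<open>n < b ^ n\<close>, for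
      \<open>n mod b ^ N = n\<close>.\<close>
    define N where "N = max N0 n"
    have N: "{j. p j \<noteq> 0} \<subseteq> {..<N}" using N0 by (auto simp: N_def)
    have "n < 2 ^ n" by (rule less_exp)
    also have "\<dots> \<le> b ^ n" using b by (rule power_mono) simp
    also have "\<dots> \<le> b ^ N" using b by (intro power_increasing) (auto simp: N_def)
    finally have "(\<Sum>j | p j \<noteq> 0. p j * b ^ j) = n"
      using sum_eq[OF N] sum_digits[of b n N] p by simp
    then show ?thesis
      using fin p b unfolding canonical_rep_def bary_partition_def le by (simp add: digits_def)
  qed
qed

section \<open>Carries when one is added\<close>

lemma Suc_div_if_dvd: "Suc n div m = (if m dvd Suc n then Suc (n div m) else n div m)"
  by (simp add: div_Suc dvd_eq_mod_eq_0)

lemma digits_eq_full: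
  assumes "b \<ge> 2" "b ^ Suc j dvd Suc n"
  shows "digits b n j = b - 1"
proof -
  have "b ^ j dvd Suc n" using assms(2) by (metis dvd_trans le_imp_power_dvd lessI less_imp_le)
  then have S: "Suc n div b ^ j = Suc (n div b ^ j)" by (simp add: Suc_div_if_dvd)
  have "Suc (n div b ^ j) mod b = 0"
    using assms by (simp flip: S dvd_eq_mod_eq_0 add: dvd_div_iff_mult power_Suc2 \<open>b ^ j dvd Suc n\<close>)
  then show ?thesis by (simp add: digits_def mod_Suc split: if_splits)
qed

text \<open>\<open>b ^ j\<close> divides \<open>Suc n\<close> exactly when the lowest
  \<open>j\<close> digits of \<open>n\<close> are all \<open>b - 1\<close>. So \<open>c\<close> is
  the place where the carry stops, and adding one is \<open>inc c\<close>: this links multiplicities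
  with sons in the tree.\<close>

lemma digits_multiplicity:
  fixes b n :: nat
  assumes b: "b \<ge> 2"
  defines "c \<equiv> multiplicity b (Suc n)"
  shows "j < c \<Longrightarrow> digits b n j = b - 1" and "digits b n c \<noteq> b - 1"
    and "digits b (Suc n) = inc c (digits b n)"
proof -
  have dvd: "b ^ j dvd Suc n \<longleftrightarrow> j \<le> c" for j
    unfolding c_def using b by (intro power_dvd_iff_le_multiplicity) auto
  show full: "digits b n j = b - 1" if "j < c" for j
    using digits_eq_full[OF b, of j n] dvd[of "Suc j"] that by simp
  have "Suc n div b ^ c mod b \<noteq> 0"
  proof
    assume "Suc n div b ^ c mod b = 0"
    then have "b dvd Suc n div b ^ c" by (simp add: dvd_eq_mod_eq_0)
    then have "b ^ Suc c dvd Suc n" using dvd[of c] b by (simp add: dvd_div_iff_mult power_Suc2)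
    then show False using dvd[of "Suc c"] by simp
  qed
  moreover have Sc: "Suc n div b ^ c = Suc (n div b ^ c)"
    using dvd[of c] by (simp add: Suc_div_if_dvd)
  ultimately have ne: "Suc (n div b ^ c mod b) \<noteq> b"
    by (simp add: mod_Suc split: if_splits)
  then show "digits b n c \<noteq> b - 1" using b by (auto simp: digits_def)
  show "digits b (Suc n) = inc c (digits b n)"
  proof
    fix j
    \<comment> \<open>Below \<open>c\<close> the carry turns \<open>b - 1\<close> into 0, at
      \<open>c\<close> it is absorbed, and above \<open>c\<close> the quotient does not
      change.\<close>
    consider "j < c" | "j = c" | "j > c" by linarith
    then show "digits b (Suc n) j = inc c (digits b n) j"
    proof cases
      case 1
      then have "Suc n div b ^ j = Suc (n div b ^ j)"
        using dvd[of j] by (simp add: Suc_div_if_dvd)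
      then show ?thesis using full[OF 1] 1 b by (simp add: digits_def inc_def mod_Suc)
    next
      case 2
      then show ?thesis using Sc ne by (simp add: digits_def inc_def mod_Suc)
    next
      case 3
      then have "Suc n div b ^ j = n div b ^ j"
        using dvd[of j] by (simp add: Suc_div_if_dvd)
      then show ?thesis using 3 by (simp add: digits_def inc_def)
    qed
  qed
qed


section \<open>Sons and rightmost branches in \<open>T\<^bsub>b\<^esub>(\<infinity>)\<close>\<close>

lemma lfull_eqI:
  assumes "\<And>j. j < l \<Longrightarrow> p j = b - 1" "p l \<noteq> b - 1"
  shows "lfull b p = l"
  unfolding lfull_def
proof (rule Greatest_equality)
  fix m assume "\<forall>j<m. p j = b - 1"
  then show "m \<le> l" using assms(2) by (meson not_le)
qed (use assms(1) in blast)

lemma T_inf_node: "p \<in> tnodes (T_inf b) \<longleftrightarrow> finite {j. p j \<noteq> 0}"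
  by (simp add: T_inf_def bary_iff)

lemma T_inf_sons:
  "length (tsons (T_inf b) p) = lfull b p + 1"
  "i \<le> lfull b p \<Longrightarrow> tsons (T_inf b) p ! i = inc i p"
  "last (tsons (T_inf b) p) = inc (lfull b p) p"
  "tsons (T_inf b) p \<noteq> []"
  by (simp_all add: T_inf_def nth_append)

lemma finite_inc: "finite {j. p j \<noteq> 0} \<Longrightarrow> finite {j. inc i p j \<noteq> 0}"
  by (rule finite_subset[of _ "insert i {j. p j \<noteq> 0}"]) (auto simp: inc_def)

text \<open>Components beyond the carry position are left free, so that this also covers nodes whose
  low components are digits and whose higher ones are not.\<close>

lemma lfull_digits:
  assumes "b \<ge> 2" "\<And>j. j < multiplicity b (Suc n) \<Longrightarrow> p j = digits b n j"
    "p (multiplicity b (Suc n)) \<noteq> b - 1"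
  shows "lfull b p = multiplicity b (Suc n)"
  using assms digits_multiplicity(1)[OF assms(1)] by (intro lfull_eqI) auto

text \<open>Here \<open>k\<close> is the position of the large component itself. Since it exceeds
  \<open>b - 1\<close>, \<open>lfull\<close> is at most \<open>k\<close> and the same for both
  nodes; incrementing at a position up to \<open>k\<close> keeps the agreement below
  \<open>k\<close> and never lowers the component at \<open>k\<close>.\<close>

lemma sim_T_inf_agree:
  assumes "b \<ge> 2" "\<And>j. j < k \<Longrightarrow> p j = q j" "p k \<ge> b" "q k \<ge> b"
  shows "sim n (tsons (T_inf b)) (tsons (T_inf b)) p q"
  using assms(2-)
proof (induction n arbitrary: p q)
  case (Suc n)
  define l where "l = (LEAST j. p j \<noteq> b - 1)"
  have pk: "p k \<noteq> b - 1" "q k \<noteq> b - 1" using assms(1) Suc.prems by auto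
  have l: "l \<le> k" "p l \<noteq> b - 1" "\<And>j. j < l \<Longrightarrow> p j = b - 1"
    unfolding l_def
    by (rule Least_le[where P = "\<lambda>j. p j \<noteq> b - 1", OF pk(1)],
        rule LeastI[where P = "\<lambda>j. p j \<noteq> b - 1", OF pk(1)], use not_less_Least in blast)
  have "lfull b p = l" using l by (intro lfull_eqI) auto
  moreover have "lfull b q = l"
  proof (rule lfull_eqI)
    show "q j = b - 1" if "j < l" for j using that l Suc.prems(1)[of j] by simp
    show "q l \<noteq> b - 1" using l pk Suc.prems(1)[of l] by (cases "l = k") auto
  qed
  moreover have "sim n (tsons (T_inf b)) (tsons (T_inf b)) (inc i p) (inc i q)" if "i \<le> l" for i
    by (rule Suc.IH) (use that l Suc.prems in \<open>auto simp: inc_def\<close>)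
  ultimately show ?case by (auto simp: list_all2_conv_all_nth T_inf_sons)
qed simp

lemma multiplicity_le_exponent:
  fixes b i :: nat
  assumes "b \<ge> 2" "i \<in> {1..b ^ K}"
  shows "multiplicity b i \<le> K"
proof -
  have "b ^ multiplicity b i \<le> i"
    using assms(2) by (intro dvd_imp_le multiplicity_dvd) auto
  then have "b ^ multiplicity b i \<le> b ^ K" using assms(2) by simp
  then show ?thesis using assms(1) by simp
qed

text \<open>The first \<open>K\<close> components form a counter running through all
  \<open>b ^ K\<close> values while the rest of \<open>r\<close> stays put. At the last value the
  counter is full, and \<open>r K \<ge> b\<close> is what ends the run of components
  \<open>b - 1\<close>.\<close>

lemma right_branch_T_inf:
  assumes b: "b \<ge> 2" and r: "r K \<ge> b" "\<forall>j<K. r j = 0"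
    and i: "i \<in> {1..b ^ K}"
  defines "w \<equiv> right_branch (T_inf b) r"
  shows "w i = (\<lambda>j. if j < K then digits b (i - 1) j else r j)" (is "_ = ?w i")
    and "lfull b (w i) = multiplicity b i"
proof -
  have lf: "lfull b (?w i) = multiplicity b i" if i: "i \<in> {1..b ^ K}" for i
  proof -
    obtain m where m: "i = Suc m" using i by (cases i) auto
    have c: "multiplicity b i \<le> K" by (rule multiplicity_le_exponent[OF b i])
    show ?thesis unfolding m
    proof (rule lfull_digits[OF b])
      let ?c = "multiplicity b (Suc m)"
      show "?w (Suc m) j = digits b m j" if "j < ?c" for j using that c m by simp
      show "?w (Suc m) ?c \<noteq> b - 1"
        using digits_multiplicity(2)[OF b, of m] r(1) b c m by (cases "?c = K") auto
    qed
  qed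
  have "i \<le> b ^ K \<Longrightarrow> w i = ?w i" if "i \<ge> 1" for i
    using that
  proof (induction i rule: dec_induct)
    case base
    then show ?case using r(2) by (auto simp: w_def right_branch_def)
  next
    case (step i)
    obtain m where m: "i = Suc m" using step.hyps by (cases i) auto
    have i: "i \<in> {1..b ^ K}" using step by simp
    \<comment> \<open>Here \<open>i < b ^ K\<close>, so the carry stays inside the counter and no
      component from \<open>K\<close> on is touched.\<close>
    have "\<not> b ^ K dvd i" using step m by (auto dest: dvd_imp_le)
    moreover have "b ^ multiplicity b i dvd i" by (rule multiplicity_dvd)
    ultimately have c: "multiplicity b i < K"
      by (metis dvd_trans le_imp_power_dvd not_le)
    have "w (Suc i) = inc (lfull b (?w i)) (?w i)"
      using step by (simp add: w_def right_branch_Suc T_inf_sons(3))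
    also have "\<dots> = ?w (Suc i)"
      unfolding lf[OF i] using digits_multiplicity(3)[OF b, of m] c m
      by (auto simp: inc_def fun_eq_iff)
    finally show ?case .
  qed
  then show "w i = ?w i" using i by simp
  then show "lfull b (w i) = multiplicity b i" using lf[OF i] by simp
qed

text \<open>The \<open>l\<close>-th son arises from \<open>inc (l - 1)\<close>. Position
  \<open>l - 1\<close> lies below the carry position, so its digit \<open>b - 1\<close> becomes
  \<open>b\<close>, with zeros before it: the form that yields X_{b,l}.\<close>

lemma inc_digits_full:
  assumes b: "b \<ge> 2" and p: "\<And>j. j < multiplicity b i \<Longrightarrow> p j = digits b (i - 1) j"
    and i: "i \<ge> 1" and l: "l \<in> {1..multiplicity b i}"
  shows "inc (l - 1) p (l - 1) = b" "j < l - 1 \<Longrightarrow> inc (l - 1) p j = 0"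
  using p[of "l - 1"] digits_multiplicity(1)[OF b, of "l - 1" "i - 1"] b i l
  by (auto simp: inc_def)


section \<open>Realising the trees \<open>X\<^bsub>b,k\<^esub>\<close> inside \<open>T\<^bsub>b\<^esub>(\<infinity>)\<close>\<close>

text \<open>A representative of the nodes with \<open>k - 1\<close> zeros followed by an entry at
  least \<open>b\<close>; the subtree below it is the model of X_{b,k}.\<close>

definition X_root :: "nat \<Rightarrow> nat \<Rightarrow> nat \<Rightarrow> nat" where
  "X_root b k = (\<lambda>j. if j = k - 1 then b else 0)"

lemma sim_X_root:
  assumes "b \<ge> 2" "p (k - 1) \<ge> b" "\<forall>j<k - 1. p j = 0"
  shows "sim n (tsons (T_inf b)) (tsons (T_inf b)) p (X_root b k)"
  by (rule sim_T_inf_agree[where k = "k - 1"]) (use assms in \<open>auto simp: X_root_def\<close>)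

text \<open>The branch and its sons are computed in \<open>T_inf b\<close> and carried over by
  \<open>sim\<close>. The label type is arbitrary so that relabelled copies are covered.\<close>

lemma X_family_of_sim:
  fixes Y :: "nat \<Rightarrow> 'a otree"
  assumes b: "b \<ge> 2" and ot: "\<And>k. k \<ge> 1 \<Longrightarrow> ordered_tree (Y k)"
    and sim: "\<And>k n. k \<ge> 1 \<Longrightarrow> sim n (tsons (Y k)) (tsons (T_inf b)) (troot (Y k)) (X_root b k)"
  shows "X_family b Y"
  unfolding X_family_def Let_def
proof (intro allI impI conjI ballI)
  fix k :: nat assume k: "k \<ge> 1"
  let ?T = "T_inf b"
  let ?w = "right_branch (Y k) (troot (Y k))" and ?u = "right_branch ?T (X_root b k)"
  show "ordered_tree (Y k)" by (rule ot[OF k])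
  have r: "X_root b k (k - 1) \<ge> b" "\<forall>j<k - 1. X_root b k j = 0"
    by (simp_all add: X_root_def)
  note u = right_branch_T_inf[OF b r]
  have s: "sim n (tsons (Y k)) (tsons ?T) (?w m) (?u m)" for n m
    by (rule sim_right_branch[OF sim[OF k] T_inf_sons(4)])
  have nonempty: "tsons (Y k) (?w m) \<noteq> []" for m
    using sim_length[OF s] T_inf_sons(4) by (metis length_0_conv)
  have node: "?w m \<in> tnodes (Y k)" for m
    using ot[OF k] right_branch_node[OF descendants_refl nonempty]
    by (simp add: ordered_tree_def)
  \<comment> \<open>Both recursive clauses reduce to this: if the counterpart \<open>q\<close> of
    \<open>p\<close> in \<open>T_inf b\<close> has \<open>l - 1\<close> zeros and then an entry at
    least \<open>b\<close>, it has the shape of \<open>X_root b l\<close>.\<close>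
  have iso: "tree_iso (subtree (Y k) p) (Y l)"
    if p: "p \<in> tnodes (Y k)" and pq: "\<And>n. sim n (tsons (Y k)) (tsons ?T) p q"
      and q: "q (l - 1) \<ge> b" "\<forall>j<l - 1. q j = 0" and l: "l \<ge> 1" for p q l
  proof (rule sim_tree_iso)
    show "sim n (tsons (subtree (Y k) p)) (tsons (Y l)) (troot (subtree (Y k) p)) (troot (Y l))" for n
      using sim_trans[OF pq sim_trans[OF sim_X_root[OF b q] sim_sym[OF sim[OF l]]]] by simp
  qed (rule ordered_tree_subtree[OF ot[OF k] p], rule ot[OF l])
  {
    fix i assume i: "i \<in> {1..b ^ (k - 1)}"
    show len: "length (tsons (Y k) (?w i)) = multiplicity b i + 1"
      using sim_length[OF s, of i] T_inf_sons(1)[of b "?u i"] u(2)[OF i] by simp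
    show "last (tsons (Y k) (?w i)) = ?w (i + 1)"
      using i by (simp add: right_branch_Suc)
    fix l assume l: "l \<in> {1..multiplicity b i}"
    let ?q = "inc (l - 1) (?u i)"
    show "tree_iso (subtree (Y k) (tsons (Y k) (?w i) ! (l - 1))) (Y l)"
    proof (rule iso)
      show "tsons (Y k) (?w i) ! (l - 1) \<in> tnodes (Y k)"
      proof -
        have "tsons (Y k) (?w i) ! (l - 1) \<in> set (tsons (Y k) (?w i))"
          using l len by (intro nth_mem) auto
        then show ?thesis
          using descendants_closed[of "?w i" "Y k" "troot (Y k)"] node[of i] ot[OF k]
          unfolding ordered_tree_def by blast
      qed
      have "tsons ?T (?u i) ! (l - 1) = ?q"
        using l u(2)[OF i] by (intro T_inf_sons(2)) auto
      moreover have "l - 1 < length (tsons ?T (?u i))"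
        unfolding T_inf_sons(1) u(2)[OF i] using l by auto
      ultimately show "sim n (tsons (Y k)) (tsons ?T) (tsons (Y k) (?w i) ! (l - 1)) ?q" for n
        using sim_nth[OF s, of "l - 1" i n] by simp
      have d: "?u i j = digits b (i - 1) j" if "j < multiplicity b i" for j
        using u(1)[OF i] multiplicity_le_exponent[OF b i] that by simp
      show "?q (l - 1) \<ge> b" "\<forall>j<l - 1. ?q j = 0"
        using inc_digits_full[OF b d _ l] i by auto
    qed (use l in simp)
  }
  have top: "b ^ (k - 1) \<in> {1..b ^ (k - 1)}" using b by simp
  have "?u (b ^ (k - 1) + 1) = inc (lfull b (?u (b ^ (k - 1)))) (?u (b ^ (k - 1)))"
    using b by (simp add: right_branch_Suc T_inf_sons(3))
  \<comment> \<open>The counter is full at index \<open>b ^ (k - 1)\<close>, of multiplicity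
    \<open>k - 1\<close>. The next node has its counter back at zero and component
    \<open>k - 1\<close> raised, so it again has the form for \<open>k\<close>.\<close>
  then have e: "?u (b ^ (k - 1) + 1) = inc (k - 1) (?u (b ^ (k - 1)))"
    using u(2)[OF top] multiplicity_same_power[of b "k - 1"] b by simp
  show "tree_iso (subtree (Y k) (?w (b ^ (k - 1) + 1))) (Y k)"
  proof (rule iso[OF node s _ _ k])
    show "?u (b ^ (k - 1) + 1) (k - 1) \<ge> b" "\<forall>j<k - 1. ?u (b ^ (k - 1) + 1) j = 0"
      using u(1)[OF top] r(1) unfolding e by (simp_all add: inc_def)
  qed
qed

text \<open>Every finitely supported function is a list padded with zeros, so a right inverse of the
  padding is injective on such functions.\<close>

lemma inj_on_finite_support_lists:
  obtains g :: "(nat \<Rightarrow> 'a::zero) \<Rightarrow> 'a list" where "inj_on g {p. finite {j. p j \<noteq> 0}}"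
proof
  have "p \<in> range (nth_default 0)" if fin: "finite {j. p j \<noteq> 0}" for p :: "nat \<Rightarrow> 'a"
  proof -
    obtain N where N: "\<forall>j\<in>{j. p j \<noteq> 0}. j < N"
      using fin unfolding finite_nat_set_iff_bounded by blast
    have "p = nth_default 0 (map p [0..<N])"
    proof
      fix j
      show "p j = nth_default 0 (map p [0..<N]) j"
        using N by (cases "j < N") (auto simp: nth_default_def)
    qed
    then show ?thesis by (rule range_eqI)
  qed
  then show "inj_on (inv (nth_default 0)) {p::nat \<Rightarrow> 'a. finite {j. p j \<noteq> 0}}"
    by (intro inj_on_inv_into) auto
qed

text \<open>The witnesses are the subtrees below \<open>X_root b k\<close>, copied onto list labels;
  the \<open>sim\<close> clause keeps their link with \<open>T_inf b\<close>.\<close>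

lemma X_family_exists:
  assumes b: "b \<ge> 2"
  obtains X :: "nat \<Rightarrow> nat list otree" where "X_family b X"
    "\<And>k n. sim n (tsons (T_inf b)) (tsons (X k)) (X_root b k) (troot (X k))"
    "\<And>k. ordered_tree (X k)"
proof -
  obtain g :: "(nat \<Rightarrow> nat) \<Rightarrow> nat list" where g: "inj_on g {p. finite {j. p j \<noteq> 0}}"
    by (rule inj_on_finite_support_lists)
  note T = T_inf_ordered_tree[OF b]
  have "\<exists>R :: nat list otree. ordered_tree R \<and> tree_iso (subtree (T_inf b) (X_root b k)) R" for k
  proof -
    have node: "X_root b k \<in> tnodes (T_inf b)" by (simp add: T_inf_node X_root_def)
    have "tnodes (subtree (T_inf b) (X_root b k)) \<subseteq> tnodes (T_inf b)"
      using T node descendants_trans unfolding ordered_tree_def by fastforce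
    then have "inj_on g (tnodes (subtree (T_inf b) (X_root b k)))"
      using T_inf_node by (intro inj_on_subset[OF g]) blast
    from ordered_tree_relabel[OF ordered_tree_subtree[OF T node] this] show ?thesis by metis
  qed
  then obtain X :: "nat \<Rightarrow> nat list otree" where
    X: "\<And>k. ordered_tree (X k)" "\<And>k. tree_iso (subtree (T_inf b) (X_root b k)) (X k)" by metis
  show thesis
    using that[OF X_family_of_sim[OF b X(1) sim_sym[OF subtree_iso_sim[OF X(2)]]]
        subtree_iso_sim[OF X(2)] X(1)] .
qed

text \<open>\<open>p\<close> agrees to every depth with \<open>X_root b k\<close>, hence with its
  copy; ordered trees that agree to every depth are isomorphic.\<close>

lemma X_subtree_root_T_inf:
  assumes b: "b \<ge> 2" and fin: "finite {j. p j \<noteq> 0}"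
    and p: "p (k - 1) \<ge> b" "\<forall>j<k - 1. p j = 0"
  shows "X_subtree_root (T_inf b) b k p"
proof -
  obtain X :: "nat \<Rightarrow> nat list otree" where X: "X_family b X"
    "\<And>k n. sim n (tsons (T_inf b)) (tsons (X k)) (X_root b k) (troot (X k))"
    "\<And>k. ordered_tree (X k)"
    using X_family_exists[OF b] by blast
  have node: "p \<in> tnodes (T_inf b)" using fin by (simp add: T_inf_node)
  have "tree_iso (subtree (T_inf b) p) (X k)"
  proof (rule sim_tree_iso)
    show "sim n (tsons (subtree (T_inf b) p)) (tsons (X k)) (troot (subtree (T_inf b) p)) (troot (X k))" for n
      using sim_trans[OF sim_X_root[OF b p] X(2)] by simp
  qed (rule ordered_tree_subtree[OF T_inf_ordered_tree[OF b] node], rule X(3))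
  then show ?thesis using node X(1) unfolding X_subtree_root_def by blast
qed

theorem theorem4:
  fixes b :: nat and v :: "nat \<Rightarrow> nat \<Rightarrow> nat"
  assumes "b \<ge> 2"
    and "v 1 = (\<lambda>_. 0)"
    and "\<And>m. m \<ge> 1 \<Longrightarrow> v (m + 1) = last (tsons (T_inf b) (v m))"
  shows "\<forall>i\<ge>1.
     (\<forall>p. canonical_rep b (i - 1) p \<longleftrightarrow> p = v i) \<and>
     length (tsons (T_inf b) (v i)) = multiplicity b i + 1 \<and>
     last (tsons (T_inf b) (v i)) = v (i + 1) \<and>
     (\<forall>j\<in>{1..multiplicity b i}.
        X_subtree_root (T_inf b) b j (tsons (T_inf b) (v i) ! (j - 1)))"
proof (intro allI impI)
  note b = assms(1)
  have lf: "lfull b (digits b n) = multiplicity b (Suc n)" for n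
    by (rule lfull_digits[OF b refl digits_multiplicity(2)[OF b]])
  \<comment> \<open>The branch starts at index 1, which shifts \<open>n\<close> by one. The last son
    is \<open>inc\<close> at the carry position, that is, addition of one.\<close>
  have v: "v (Suc n) = digits b n" for n
  proof (induction n)
    case (Suc n)
    then show ?case
      using assms(3)[of "Suc n"] digits_multiplicity(3)[OF b, of n] by (simp add: T_inf_sons(3) lf)
  qed (use assms(2) in simp)
  fix i :: nat assume i: "i \<ge> 1"
  then have vi: "v i = digits b (i - 1)" using v[of "i - 1"] by simp
  have lfi: "lfull b (v i) = multiplicity b i" using lf[of "i - 1"] vi i by simp
  have "X_subtree_root (T_inf b) b j (tsons (T_inf b) (v i) ! (j - 1))"
    if j: "j \<in> {1..multiplicity b i}" for j
  proof -
    have "tsons (T_inf b) (v i) ! (j - 1) = inc (j - 1) (v i)"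
      using j lfi by (intro T_inf_sons(2)) auto
    moreover have "X_subtree_root (T_inf b) b j (inc (j - 1) (v i))"
    proof (rule X_subtree_root_T_inf[OF b])
      show "finite {k. inc (j - 1) (v i) k \<noteq> 0}"
        unfolding vi by (rule finite_inc[OF finite_digits[OF b]])
    qed (use inc_digits_full[OF b _ i j, of "v i"] vi in simp_all)
    ultimately show ?thesis by simp
  qed
  then show "(\<forall>p. canonical_rep b (i - 1) p \<longleftrightarrow> p = v i) \<and>
     length (tsons (T_inf b) (v i)) = multiplicity b i + 1 \<and>
     last (tsons (T_inf b) (v i)) = v (i + 1) \<and>
     (\<forall>j\<in>{1..multiplicity b i}.
        X_subtree_root (T_inf b) b j (tsons (T_inf b) (v i) ! (j - 1)))"
    using canonical_rep_iff_digits[OF b] vi lfi assms(3)[OF i] by (simp add: T_inf_sons(1))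
qed

end
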